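(* Let $r>1$ and $n$ be positive integers and $a,b\ge0$. Then $F_{n,r}(\mathbf x,\mathbf y,a,b)$ is stable as a polynomial in the $2n$ variables $x_1,\ldots,x_n,y_1,\ldots,y_n$.
   Context: $\mathbb Z_r\wr\mathfrak S_n=\{(\kappa,\sigma):\kappa:[n]\to\mathbb Z_r,\ \sigma\in\mathfrak S_n\}$. For $\pi=(\kappa,\sigma)$: $i\in\mathcal X(\pi)$ iff $\sigma(i)>i$, or $\sigma(i)=i$ and $\kappa_i\ne0$; $\sigma(i)\in\mathcal Y(\pi)$ iff $\sigma(i)<i$, or $\sigma(i)=i$ and $\kappa_i=0$. A cycle of $\sigma$ is a zero cycle if $\kappa_i=0$ for its maximal element $i$, otherwise a non-zero cycle; $\mathrm{zc}(\pi)$, $\mathrm{nc}(\pi)$ are the numbers of zero and non-zero cycles. $$F_{n,r}(\mathbf x,\mathbf y,a,b)=\sum_{\pi\in\mathbb Z_r\wr\mathfrak S_n}a^{\mathrm{nc}(\pi)}b^{\mathrm{zc}(\pi)}\prod_{i\in\mathcal X(\pi)}x_i\prod_{j\in\mathcal Y(\pi)}y_j.$$ A polynomial $P(z_1,\ldots,z_m)$ is stable if $P(z_1,\ldots,z_m)\ne0$ whenever $\Im(z_j)>0$ for all $j$; following the standard convention, the identically zero polynomial is also regarded as stable. *)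

theory Defs
  imports Complex_Main "HOL-Library.FuncSet" "HOL-Combinatorics.Permutations"
    "HOL-Combinatorics.Orbits"
begin

text \<open>The residues modulo \<open>r\<close> are represented by \<open>{0..<r}\<close>; a colouring is extensional
  outside \<open>{1..n}\<close>, so that the set below is finite and lists each coloured permutation once.\<close>

definition coloured_perms :: "nat \<Rightarrow> nat \<Rightarrow> ((nat \<Rightarrow> nat) \<times> (nat \<Rightarrow> nat)) set" where
  "coloured_perms r n = ({1..n} \<rightarrow>\<^sub>E {0..<r}) \<times> {\<sigma>. \<sigma> permutes {1..n}}"

definition X_set :: "nat \<Rightarrow> (nat \<Rightarrow> nat) \<times> (nat \<Rightarrow> nat) \<Rightarrow> nat set" where
  "X_set n = (\<lambda>(\<kappa>, \<sigma>). {i \<in> {1..n}. \<sigma> i > i \<or> (\<sigma> i = i \<and> \<kappa> i \<noteq> 0)})"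

definition Y_set :: "nat \<Rightarrow> (nat \<Rightarrow> nat) \<times> (nat \<Rightarrow> nat) \<Rightarrow> nat set" where
  "Y_set n = (\<lambda>(\<kappa>, \<sigma>). \<sigma> ` {i \<in> {1..n}. \<sigma> i < i \<or> (\<sigma> i = i \<and> \<kappa> i = 0)})"

text \<open>Cycles are identified with their supports; fixed points give singleton cycles.\<close>

definition cycles_of :: "nat \<Rightarrow> (nat \<Rightarrow> nat) \<Rightarrow> nat set set" where
  "cycles_of n \<sigma> = orbit \<sigma> ` {1..n}"

definition zc :: "nat \<Rightarrow> (nat \<Rightarrow> nat) \<times> (nat \<Rightarrow> nat) \<Rightarrow> nat" where
  "zc n = (\<lambda>(\<kappa>, \<sigma>). card {C \<in> cycles_of n \<sigma>. \<kappa> (Max C) = 0})"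

definition nc :: "nat \<Rightarrow> (nat \<Rightarrow> nat) \<times> (nat \<Rightarrow> nat) \<Rightarrow> nat" where
  "nc n = (\<lambda>(\<kappa>, \<sigma>). card {C \<in> cycles_of n \<sigma>. \<kappa> (Max C) \<noteq> 0})"

definition F_poly ::
  "nat \<Rightarrow> nat \<Rightarrow> (nat \<Rightarrow> complex) \<Rightarrow> (nat \<Rightarrow> complex) \<Rightarrow> real \<Rightarrow> real \<Rightarrow> complex" where
  "F_poly n r x y a b =
     (\<Sum>\<pi>\<in>coloured_perms r n.
        of_real (a ^ nc n \<pi> * b ^ zc n \<pi>) * (\<Prod>i\<in>X_set n \<pi>. x i) * (\<Prod>j\<in>Y_set n \<pi>. y j))"

text \<open>A polynomial in the variables indexed by \<open>V\<close> is represented by its polynomial function,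
  which over the complex numbers determines it. The first disjunct is the convention that
  the zero polynomial is stable.\<close>

definition stable_poly :: "'v set \<Rightarrow> (('v \<Rightarrow> complex) \<Rightarrow> complex) \<Rightarrow> bool" where
  "stable_poly V P \<longleftrightarrow>
     (\<forall>z. P z = 0) \<or> (\<forall>z. (\<forall>v\<in>V. Im (z v) > 0) \<longrightarrow> P z \<noteq> 0)"

end

theory Submission imports Defs begin

text \<open>Put \<open>c = (r - 1) a + b\<close>; if \<open>c = 0\<close> then \<open>F\<close> vanishes. Otherwise, summing out the colours,
  every cycle of \<open>\<sigma>\<close> contributes \<open>c / r\<close>, every letter \<open>r\<close>, and every arc \<open>i \<mapsto> \<sigma> i\<close> a variable:
  \<open>x\<^sub>i\<close> or \<open>y\<^sub>\<sigma>\<^sub>i\<close> according to its direction, a convex combination of the two at a fixed point.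
  Inserting \<open>n + 1\<close> into an arc replaces its variable by \<open>x\<^sub>i y\<^sub>\<sigma>\<^sub>i\<close>, which gives the recursion
  \<open>F\<^sub>n\<^sub>+\<^sub>1 = ((r - 1) a x\<^sub>n\<^sub>+\<^sub>1 + b y\<^sub>n\<^sub>+\<^sub>1) F\<^sub>n + r (\<Sum>v. v F\<^sub>n[v := 0])\<close> over all variables \<open>v\<close> of \<open>F\<^sub>n\<close>.
  Since \<open>F\<^sub>n\<close> is affine in \<open>v\<close> and stable, \<open>v F\<^sub>n[v := 0] / F\<^sub>n\<close> has nonnegative imaginary part on the
  upper half plane, so \<open>F\<^sub>n\<^sub>+\<^sub>1 / F\<^sub>n\<close> has positive imaginary part there.\<close>

section \<open>Inserting a new maximum into a permutation\<close>

lemma permutes_orbit_eq: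
  assumes "finite S" "\<sigma> permutes S" "y \<in> orbit \<sigma> x"
  shows "orbit \<sigma> y = orbit \<sigma> x"
proof -
  have "permutation \<sigma>"
    using assms by (auto simp: permutation_permutes)
  then have "x \<in> orbit \<sigma> y"
    using assms(3) by (meson orbit_swap permutation_self_in_orbit)
  then show ?thesis
    using assms(3) by (auto intro: orbit_trans)
qed

lemma permutes_self_in_orbit:
  assumes "finite S" "\<sigma> permutes S"
  shows "x \<in> orbit \<sigma> x"
  using assms by (intro permutation_self_in_orbit) (auto simp: permutation_permutes)

lemma finite_cycles_of [simp]: "finite (cycles_of n \<sigma>)"
  by (simp add: cycles_of_def)

lemma cycles_of_subset:
  assumes "\<sigma> permutes {1..n}" "C \<in> cycles_of n \<sigma>"
  shows "C \<subseteq> {1..n}" "C \<noteq> {}" "finite C"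
proof -
  show "C \<subseteq> {1..n}"
    using assms by (auto simp: cycles_of_def dest: permutes_orbit_subset)
  then show "finite C"
    by (rule finite_subset) simp
  show "C \<noteq> {}"
    using assms(2) permutes_self_in_orbit[OF _ assms(1)] by (force simp: cycles_of_def)
qed

text \<open>Distinct cycles are disjoint, so a cycle is determined by its maximum. This lets a
  single letter carry the colour weight of its whole cycle.\<close>

lemma inj_on_Max_cycles_of:
  assumes "\<sigma> permutes {1..n}"
  shows "inj_on Max (cycles_of n \<sigma>)"
proof (rule inj_onI)
  fix C D assume C: "C \<in> cycles_of n \<sigma>" and D: "D \<in> cycles_of n \<sigma>" and eq: "Max C = Max D"
  have "orbit \<sigma> (Max E) = E" if E: "E \<in> cycles_of n \<sigma>" for E
  proof -
    have "Max E \<in> E"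
      using cycles_of_subset[OF assms E] by simp
    moreover obtain k where "E = orbit \<sigma> k"
      using E unfolding cycles_of_def by blast
    ultimately show ?thesis
      using permutes_orbit_eq[OF _ assms] by simp
  qed
  then show "C = D"
    using C D eq by metis
qed

lemma card_cycles_of_Suc:
  assumes "\<sigma> permutes {1..n}"
  shows "card (cycles_of (Suc n) \<sigma>) = Suc (card (cycles_of n \<sigma>))"
proof -
  have "orbit \<sigma> (Suc n) = {Suc n}"
    using assms by (simp add: orbit_eq_singleton_iff permutes_def)
  moreover have "{Suc n} \<notin> cycles_of n \<sigma>"
    using cycles_of_subset(1)[OF assms] by fastforce
  ultimately show ?thesis
    by (simp add: cycles_of_def atLeastAtMostSuc_conv)
qed

text \<open>The composition reroutes the arc entering \<open>b\<close> through \<open>Suc n\<close>: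
  if \<open>\<sigma> k = b\<close>, then \<open>k\<close> goes to \<open>Suc n\<close> and
  \<open>Suc n\<close> to \<open>b\<close>. One cycle becomes longer and none is created.\<close>

lemma card_cycles_of_transpose:
  assumes \<sigma>: "\<sigma> permutes {1..n}" and b: "b \<in> {1..n}"
  shows "card (cycles_of (Suc n) (transpose (Suc n) b \<circ> \<sigma>)) = card (cycles_of n \<sigma>)"
proof -
  define \<tau> where "\<tau> = transpose (Suc n) b \<circ> \<sigma>"
  \<comment> \<open>\<open>\<phi>\<close> carries the cycles of \<open>\<sigma>\<close> to those of
    \<open>\<tau>\<close>; deleting \<open>Suc n\<close> undoes it.\<close>
  define \<phi> where "\<phi> C = (if b \<in> C then insert (Suc n) C else C)" for C
  have \<sigma>N: "\<sigma> (Suc n) = Suc n"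
    using \<sigma> by (simp add: permutes_def)
  have \<tau>N: "\<tau> (Suc n) = b"
    by (simp add: \<tau>_def \<sigma>N)
  have \<tau>: "\<tau> k = (if \<sigma> k = b then Suc n else \<sigma> k)" if "k \<in> {1..n}" for k
    using permutes_in_image[OF \<sigma>, of k] that by (auto simp: \<tau>_def transpose_def)
  have \<tau>_perm: "\<tau> permutes {1..Suc n}"
    unfolding \<tau>_def using b
    by (intro permutes_compose[OF permutes_subset[OF \<sigma>]] permutes_swap_id) auto
  have orb: "orbit \<tau> k = \<phi> (orbit \<sigma> k)" if k: "k \<in> {1..n}" for k
  proof -
    have sub: "orbit \<sigma> k \<subseteq> {1..n}"
      using \<sigma> k by (rule permutes_orbit_subset)
    \<comment> \<open>If \<open>\<sigma> y = b\<close>, then \<open>\<tau>\<close> reaches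
      \<open>b\<close> from \<open>y\<close> in two steps, by way of \<open>Suc n\<close>.\<close>
    have closed: "\<sigma> y \<in> orbit \<tau> k" if "y \<in> {1..n}" "\<tau> y \<in> orbit \<tau> k" for y
      using that \<tau>[of y] orbit.step[of "Suc n" \<tau> k] \<tau>N by (auto split: if_splits)
    have "y \<in> orbit \<tau> k" if "y \<in> orbit \<sigma> k" for y
      using that
    proof induction
      case base
      show ?case by (rule closed[OF k]) (rule orbit.base)
    next
      case (step y)
      show ?case
        using step sub by (intro closed) (auto intro: orbit.step)
    qed
    then have sub1: "orbit \<sigma> k \<subseteq> orbit \<tau> k" by blast
    have new: "Suc n \<in> orbit \<tau> k" if "b \<in> orbit \<sigma> k"
      using that
    proof cases
      case base
      then show ?thesis using \<tau>[OF k] orbit.base[of \<tau> k] by simp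
    next
      case (step y)
      then have "y \<in> {1..n}" "y \<in> orbit \<tau> k"
        using sub sub1 by blast+
      then show ?thesis
        using \<tau>[of y] step(1) orbit.step[of y \<tau> k] by simp
    qed
    have "y \<in> \<phi> (orbit \<sigma> k)" if "y \<in> orbit \<tau> k" for y
      using that
    proof induction
      case base
      show ?case using \<tau>[OF k] orbit.base[of \<sigma> k] by (auto simp: \<phi>_def)
    next
      case (step y)
      then show ?case
        using \<tau>[of y] \<tau>N sub orbit.step[of y \<sigma> k] by (auto simp: \<phi>_def split: if_splits)
    qed
    then show ?thesis
      using sub1 new unfolding \<phi>_def by (cases "b \<in> orbit \<sigma> k") (simp_all, blast+)
  qed
  have "orbit \<tau> (Suc n) = orbit \<tau> b"
    using permutes_orbit_eq[OF _ \<tau>_perm, of b "Suc n"] orbit.base[of \<tau> "Suc n"] \<tau>N by simp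
  then have "cycles_of (Suc n) \<tau> = orbit \<tau> ` {1..n}"
    using b by (auto simp: cycles_of_def atLeastAtMostSuc_conv)
  also have "\<dots> = \<phi> ` cycles_of n \<sigma>"
    using orb by (auto simp: cycles_of_def)
  finally have "cycles_of (Suc n) \<tau> = \<phi> ` cycles_of n \<sigma>" .
  moreover have "inj_on \<phi> (cycles_of n \<sigma>)"
  proof (rule inj_on_inverseI)
    fix C assume "C \<in> cycles_of n \<sigma>"
    then have "Suc n \<notin> C"
      using cycles_of_subset(1)[OF \<sigma>] by fastforce
    then show "\<phi> C - {Suc n} = C"
      by (auto simp: \<phi>_def)
  qed
  ultimately show ?thesis
    by (simp add: card_image \<tau>_def)
qed

section \<open>Summing out the colours\<close>

text \<open>The weight of an arc from \<open>i\<close> to \<open>j\<close> once the colours are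
  summed out. The last branch is reached only for \<open>i = j\<close>; writing \<open>y j\<close>
  there keeps \<open>x\<close> evaluated at the tail and \<open>y\<close> at the head.\<close>

definition arc :: "complex \<Rightarrow> complex \<Rightarrow> (nat \<Rightarrow> complex) \<Rightarrow> (nat \<Rightarrow> complex) \<Rightarrow> nat \<Rightarrow> nat \<Rightarrow> complex" where
  "arc p q x y i j = (if i < j then x i else if j < i then y j else p * x i + q * y j)"

lemma arc_cong:
  "x i = x' i \<Longrightarrow> y j = y' j \<Longrightarrow> arc p q x y i j = arc p q x' y' i j"
  by (simp only: arc_def)

text \<open>In the application \<open>r\<close> counts the colours of a letter, \<open>s\<close> is
  \<open>c / r\<close> with \<open>c = (r - 1) a + b\<close>, and \<open>p\<close>, \<open>q\<close>
  are the shares of \<open>(r - 1) a\<close> and \<open>b\<close> in \<open>c\<close>.\<close>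

definition cycle_weight :: "nat \<Rightarrow> complex \<Rightarrow> complex \<Rightarrow> complex \<Rightarrow> complex \<Rightarrow>
    (nat \<Rightarrow> complex) \<Rightarrow> (nat \<Rightarrow> complex) \<Rightarrow> (nat \<Rightarrow> nat) \<Rightarrow> complex" where
  "cycle_weight n r s p q x y \<sigma> =
     s ^ card (cycles_of n \<sigma>) * r ^ n * (\<Prod>i=1..n. arc p q x y i (\<sigma> i))"

definition cycle_poly :: "nat \<Rightarrow> complex \<Rightarrow> complex \<Rightarrow> complex \<Rightarrow> complex \<Rightarrow>
    (nat \<Rightarrow> complex) \<Rightarrow> (nat \<Rightarrow> complex) \<Rightarrow> complex" where
  "cycle_poly n r s p q x y = (\<Sum>\<sigma> | \<sigma> permutes {1..n}. cycle_weight n r s p q x y \<sigma>)"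

text \<open>The weight of a coloured permutation is a product over letters in which
  \<open>\<kappa> i\<close> enters only the factor of \<open>i\<close>, the \<open>a\<close> or
  \<open>b\<close> of a cycle being placed at its maximum. The distributive law then turns the sum
  over colourings into a product of sums over single colours.\<close>

lemma F_poly_eq_sum_prod:
  fixes a b :: real
  shows "F_poly n r x y a b = (\<Sum>\<sigma> | \<sigma> permutes {1..n}. \<Prod>i=1..n. \<Sum>k<r.
     (if i \<in> Max ` cycles_of n \<sigma> then of_real (if k = 0 then b else a) else 1) *
     (if i < \<sigma> i \<or> (\<sigma> i = i \<and> k \<noteq> 0) then x i else y (\<sigma> i)))"
proof -
  define g where "g \<sigma> i k =
     (if i \<in> Max ` cycles_of n \<sigma> then of_real (if k = 0 then b else a) else 1) *
     (if i < \<sigma> i \<or> (\<sigma> i = i \<and> k \<noteq> 0) then x i else y (\<sigma> i))" for \<sigma> and i k :: nat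
  have weight: "of_real (a ^ nc n (\<kappa>, \<sigma>) * b ^ zc n (\<kappa>, \<sigma>)) * (\<Prod>i\<in>X_set n (\<kappa>, \<sigma>). x i) *
      (\<Prod>j\<in>Y_set n (\<kappa>, \<sigma>). y j) = (\<Prod>i=1..n. g \<sigma> i (\<kappa> i))"
    if \<sigma>: "\<sigma> permutes {1..n}" for \<kappa> \<sigma>
  proof -
    define M where "M = Max ` cycles_of n \<sigma>"
    let ?B = "{i \<in> {1..n}. \<not> (i < \<sigma> i \<or> (\<sigma> i = i \<and> \<kappa> i \<noteq> 0))}"
    have M: "M \<subseteq> {1..n}"
      unfolding M_def using cycles_of_subset[OF \<sigma>] Max_in by blast
    note inj = inj_on_Max_cycles_of[OF \<sigma>]
    have "(\<Prod>i=1..n. (if i \<in> M then (if \<kappa> i = 0 then b else a) else 1))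
        = (\<Prod>i\<in>M. if \<kappa> i = 0 then b else a)"
      using M by (simp add: prod.inter_restrict[symmetric] Int_absorb1)
    also have "\<dots> = (\<Prod>C\<in>cycles_of n \<sigma>. if \<kappa> (Max C) = 0 then b else a)"
      unfolding M_def by (rule prod.reindex_cong[OF inj]) auto
    also have "\<dots> = a ^ nc n (\<kappa>, \<sigma>) * b ^ zc n (\<kappa>, \<sigma>)"
      by (simp add: prod.If_cases nc_def zc_def Collect_conj_eq Collect_neg_eq mult.commute del: bot_nat_0.not_eq_extremum neq0_conv)
    finally have colours: "(\<Prod>i=1..n. (if i \<in> M then (if \<kappa> i = 0 then b else a) else 1)) =
        a ^ nc n (\<kappa>, \<sigma>) * b ^ zc n (\<kappa>, \<sigma>)" .
    have c: "of_real (a ^ nc n (\<kappa>, \<sigma>) * b ^ zc n (\<kappa>, \<sigma>)) =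
        (\<Prod>i=1..n. (if i \<in> M then of_real (if \<kappa> i = 0 then b else a) else (1::complex)))"
      unfolding colours[symmetric] of_real_prod by (intro prod.cong) auto
    \<comment> \<open>The conditions defining \<open>X_set\<close> and \<open>Y_set\<close> are
      complementary in the tail \<open>i\<close>, so both products merge into one over all
      tails.\<close>
    have Y: "Y_set n (\<kappa>, \<sigma>) = \<sigma> ` ?B"
      by (auto simp: Y_set_def not_less le_less)
    have "(\<Prod>j\<in>Y_set n (\<kappa>, \<sigma>). y j) = (\<Prod>i\<in>?B. y (\<sigma> i))"
      unfolding Y by (rule prod.reindex_cong[OF inj_on_subset[OF permutes_inj_on[OF \<sigma>, of UNIV]]]) auto
    then have "(\<Prod>i\<in>X_set n (\<kappa>, \<sigma>). x i) * (\<Prod>j\<in>Y_set n (\<kappa>, \<sigma>). y j) =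
        (\<Prod>i=1..n. if i < \<sigma> i \<or> (\<sigma> i = i \<and> \<kappa> i \<noteq> 0) then x i else y (\<sigma> i))"
      by (subst prod.If_cases)
        (auto simp: X_set_def simp del: not_less intro!: arg_cong2[of _ _ _ _ times] prod.cong)
    with c show ?thesis
      by (simp add: g_def M_def prod.distrib mult.assoc)
  qed
  have "F_poly n r x y a b = (\<Sum>\<kappa>\<in>{1..n} \<rightarrow>\<^sub>E {0..<r}. \<Sum>\<sigma> | \<sigma> permutes {1..n}. \<Prod>i=1..n. g \<sigma> i (\<kappa> i))"
    unfolding F_poly_def coloured_perms_def sum.cartesian_product
    by (intro sum.cong refl) (use weight in auto)
  also have "\<dots> = (\<Sum>\<sigma> | \<sigma> permutes {1..n}. \<Sum>\<kappa>\<in>{1..n} \<rightarrow>\<^sub>E {0..<r}. \<Prod>i=1..n. g \<sigma> i (\<kappa> i))"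
    by (rule sum.swap)
  also have "\<dots> = (\<Sum>\<sigma> | \<sigma> permutes {1..n}. \<Prod>i=1..n. \<Sum>k<r. g \<sigma> i k)"
    by (simp add: prod_sum_PiE atLeast0LessThan)
  finally show ?thesis
    by (simp add: g_def)
qed

text \<open>The comparison is letter by letter. Off the fixed points the colours sum to
  \<open>c\<close>, which is \<open>c / r\<close> times \<open>r\<close>, at a cycle maximum and to
  \<open>r\<close> elsewhere; a fixed point gives \<open>b y + (r - 1) a x\<close>, which is
  \<open>c\<close> times its \<open>arc\<close> weight.\<close>

lemma F_poly_eq_cycle_poly:
  fixes a b c :: real
  assumes r: "r > 0" and c: "c = real (r - 1) * a + b" "c \<noteq> 0"
  shows "F_poly n r x y a b = cycle_poly n (of_nat r) (of_real (c / real r))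
           (of_real (real (r - 1) * a / c)) (of_real (b / c)) x y"
  unfolding F_poly_eq_sum_prod cycle_poly_def
proof (rule sum.cong[OF refl], clarify)
  fix \<sigma> assume \<sigma>: "\<sigma> permutes {1..n}"
  define M where "M = Max ` cycles_of n \<sigma>"
  let ?A = "arc (of_real (real (r - 1) * a / c)) (of_real (b / c)) x y"
  \<comment> \<open>Only colour 0 is distinguished; the other \<open>r - 1\<close> colours
    contribute equally.\<close>
  have split: "(\<Sum>k<r. h k) = h 0 + of_nat (r - 1) * d" if "\<And>k. k > 0 \<Longrightarrow> h k = d"
    for h :: "nat \<Rightarrow> complex" and d
    using r that by (cases r) (simp_all add: sum.lessThan_Suc_shift del: sum.lessThan_Suc)
  have M: "M \<subseteq> {1..n}"
    unfolding M_def using cycles_of_subset[OF \<sigma>] Max_in by blast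
  \<comment> \<open>A fixed point is the maximum of its singleton cycle, so it always carries a
    cycle factor.\<close>
  have fixM: "i \<in> M" if "\<sigma> i = i" "i \<in> {1..n}" for i
  proof -
    have "{i} \<in> cycles_of n \<sigma>"
      using that orbit_eq_singleton_iff[of \<sigma> i] by (metis cycles_of_def imageI)
    then show ?thesis
      by (force simp: M_def)
  qed
  have "(\<Sum>k<r. (if i \<in> M then of_real (if k = 0 then b else a) else 1) *
       (if i < \<sigma> i \<or> (\<sigma> i = i \<and> k \<noteq> 0) then x i else y (\<sigma> i)))
     = (if i \<in> M then of_real (c / real r) else 1) * of_nat r * ?A i (\<sigma> i)"
    if i: "i \<in> {1..n}" for i
  proof -
    have c': "complex_of_real c = of_nat (r - 1) * of_real a + of_real b" "complex_of_real c \<noteq> 0"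
      by (metis c(1) of_real_add of_real_mult of_real_of_nat_eq) (simp add: c(2))
    have r': "of_nat (r - 1) + 1 = (of_nat r :: complex)" "(of_nat r :: complex) \<noteq> 0"
      using r by (auto simp: of_nat_diff)
    show ?thesis
    proof (cases "\<sigma> i = i")
      case True
      have "(\<Sum>k<r. of_real (if k = 0 then b else a) * (if k \<noteq> 0 then x i else y (\<sigma> i)))
          = of_real b * y i + of_nat (r - 1) * (of_real a * x i)"
        by (subst split[where d = "of_real a * x i"]) (auto simp: True)
      moreover have "of_real (c / real r) * of_nat r = complex_of_real c"
        using r'(2) by simp
      moreover have "complex_of_real c * (of_real (real (r - 1) * a / c) * x i + of_real (b / c) * y i)
          = of_real b * y i + of_nat (r - 1) * (of_real a * x i)"
        using c'(2) by (simp add: distrib_left del: of_nat_diff)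
      ultimately show ?thesis
        using fixM[OF True i] True by (simp add: arc_def del: of_nat_diff of_real_divide)
    next
      case False
      define w where "w = (if i < \<sigma> i then x i else y (\<sigma> i))"
      have "(\<Sum>k<r. (if i \<in> M then of_real (if k = 0 then b else a) else 1) * w)
          = (if i \<in> M then of_real c else of_nat r) * w"
        by (subst split[where d = "(if i \<in> M then of_real a else 1) * w"])
          (auto simp: c'(1) r'(1)[symmetric] algebra_simps simp del: of_nat_diff)
      moreover have "?A i (\<sigma> i) = w"
        using False by (auto simp: arc_def w_def)
      ultimately show ?thesis
        using False r'(2) by (simp add: w_def)
    qed
  qed
  then have "(\<Prod>i=1..n. \<Sum>k<r. (if i \<in> M then of_real (if k = 0 then b else a) else 1) *
       (if i < \<sigma> i \<or> (\<sigma> i = i \<and> k \<noteq> 0) then x i else y (\<sigma> i)))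
    = (\<Prod>i=1..n. (if i \<in> M then of_real (c / real r) else 1) * of_nat r * ?A i (\<sigma> i))"
    by (intro prod.cong) auto
  also have "\<dots> = (\<Prod>i=1..n. (if i \<in> M then of_real (c / real r) else 1)) * of_nat r ^ n *
      (\<Prod>i=1..n. ?A i (\<sigma> i))"
    by (simp add: prod.distrib)
  also have "(\<Prod>i=1..n. (if i \<in> M then of_real (c / real r) else (1::complex)))
      = of_real (c / real r) ^ card M"
    using M by (simp add: prod.inter_restrict[symmetric] Int_absorb1)
  also have "card M = card (cycles_of n \<sigma>)"
    unfolding M_def by (rule card_image[OF inj_on_Max_cycles_of[OF \<sigma>]])
  finally show "(\<Prod>i=1..n. \<Sum>k<r.
     (if i \<in> Max ` cycles_of n \<sigma> then of_real (if k = 0 then b else a) else 1) *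
     (if i < \<sigma> i \<or> (\<sigma> i = i \<and> k \<noteq> 0) then x i else y (\<sigma> i)))
    = cycle_weight n (of_nat r) (of_real (c / real r))
        (of_real (real (r - 1) * a / c)) (of_real (b / c)) x y \<sigma>"
    by (simp only: cycle_weight_def M_def)
qed

section \<open>The recursion\<close>

text \<open>The arc from \<open>j\<close> to \<open>\<sigma> j\<close> is replaced by an ascent from
  \<open>j\<close> to \<open>Suc n\<close> and a descent to \<open>\<sigma> j\<close>, of joint
  weight \<open>x j * y (\<sigma> j)\<close>. The right side recovers this product by setting one
  variable of the old arc to zero at a time.\<close>

lemma cycle_weight_transpose:
  assumes \<sigma>: "\<sigma> permutes {1..n}" and j: "j \<in> {1..n}" and pq: "p + q = 1"
  shows "cycle_weight (Suc n) r s p q x y (transpose (Suc n) (\<sigma> j) \<circ> \<sigma>) =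
    r * (x j * cycle_weight n r s p q (x(j := 0)) y \<sigma> +
         y (\<sigma> j) * cycle_weight n r s p q x (y(\<sigma> j := 0)) \<sigma>)"
proof -
  let ?\<tau> = "transpose (Suc n) (\<sigma> j) \<circ> \<sigma>"
  have \<sigma>j: "\<sigma> j \<in> {1..n}"
    using permutes_in_image[OF \<sigma>] j by blast
  have inj: "\<sigma> i = \<sigma> k \<longleftrightarrow> i = k" for i k
    using permutes_inj[OF \<sigma>] by (auto dest: injD)
  have \<sigma>N: "\<sigma> (Suc n) = Suc n"
    using \<sigma> by (simp add: permutes_def)
  define R where "R = (\<Prod>i\<in>{1..n} - {j}. arc p q x y i (\<sigma> i))"
  have rest: "?\<tau> i = \<sigma> i" if "i \<in> {1..n} - {j}" for i
    using that permutes_in_image[OF \<sigma>, of i] by (auto simp: transpose_def inj)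
  have "(\<Prod>i=1..Suc n. arc p q x y i (?\<tau> i)) =
      arc p q x y (Suc n) (?\<tau> (Suc n)) * (arc p q x y j (?\<tau> j) *
        (\<Prod>i\<in>{1..n} - {j}. arc p q x y i (?\<tau> i)))"
    using prod.remove[of "{1..n}" j "\<lambda>i. arc p q x y i (?\<tau> i)"] j
    by (simp only: prod.nat_ivl_Suc' le_add1 finite_atLeastAtMost)
  also have "(\<Prod>i\<in>{1..n} - {j}. arc p q x y i (?\<tau> i)) = R"
    unfolding R_def by (intro prod.cong refl) (simp add: rest del: o_apply)
  also have "arc p q x y (Suc n) (?\<tau> (Suc n)) = y (\<sigma> j)"
    using \<sigma>j by (auto simp: arc_def \<sigma>N)
  also have "arc p q x y j (?\<tau> j) = x j"
    using j by (auto simp: arc_def)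
  finally have L: "(\<Prod>i=1..Suc n. arc p q x y i (?\<tau> i)) = y (\<sigma> j) * (x j * R)" .
  have X: "(\<Prod>i=1..n. arc p q (x(j := 0)) y i (\<sigma> i)) = arc p q (x(j := 0)) y j (\<sigma> j) * R"
    unfolding R_def using j
    by (subst prod.remove[of _ j]) (auto intro!: prod.cong arc_cong)
  \<comment> \<open>By injectivity of \<open>\<sigma>\<close>, no other arc ends in
    \<open>\<sigma> j\<close>.\<close>
  have "arc p q x (y(\<sigma> j := 0)) i (\<sigma> i) = arc p q x y i (\<sigma> i)" if "i \<noteq> j" for i
    using that inj[of i j] by (intro arc_cong) simp_all
  then have Y: "(\<Prod>i=1..n. arc p q x (y(\<sigma> j := 0)) i (\<sigma> i)) = arc p q x (y(\<sigma> j := 0)) j (\<sigma> j) * R"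
    unfolding R_def using j
    by (subst prod.remove[of _ j]) (auto intro!: prod.cong)
  \<comment> \<open>Off the diagonal exactly one summand survives; at a fixed point the two give
    \<open>q\<close> and \<open>p\<close> times the product, whence the need for
    \<open>p + q = 1\<close>.\<close>
  have key: "x j * arc p q (x(j := 0)) y j (\<sigma> j) + y (\<sigma> j) * arc p q x (y(\<sigma> j := 0)) j (\<sigma> j)
      = x j * y (\<sigma> j)"
  proof (cases "\<sigma> j = j")
    case True
    have "x j * (q * y j) + y j * (p * x j) = (p + q) * (x j * y j)"
      by (simp add: algebra_simps)
    then show ?thesis
      using True pq by (simp add: arc_def)
  qed (auto simp: arc_def)
  define K where "K = s ^ card (cycles_of n \<sigma>) * r ^ n"
  have "cycle_weight (Suc n) r s p q x y ?\<tau> = r * K * R * (x j * y (\<sigma> j))"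
    unfolding cycle_weight_def L card_cycles_of_transpose[OF \<sigma> \<sigma>j]
    by (simp add: K_def mult_ac)
  also have "\<dots> = r * (x j * cycle_weight n r s p q (x(j := 0)) y \<sigma> +
         y (\<sigma> j) * cycle_weight n r s p q x (y(\<sigma> j := 0)) \<sigma>)"
    unfolding cycle_weight_def X Y key[symmetric] K_def by (simp add: algebra_simps)
  finally show ?thesis .
qed

lemma cycle_weight_Suc:
  assumes "\<sigma> permutes {1..n}"
  shows "cycle_weight (Suc n) r s p q x y \<sigma> =
    r * s * (p * x (Suc n) + q * y (Suc n)) * cycle_weight n r s p q x y \<sigma>"
proof -
  have "\<sigma> (Suc n) = Suc n"
    using assms by (simp add: permutes_def)
  then show ?thesis
    by (simp add: cycle_weight_def card_cycles_of_Suc[OF assms] arc_def)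
qed

text \<open>Each permutation of \<open>{1..Suc n}\<close> is uniquely
  \<open>transpose (Suc n) b \<circ> \<sigma>\<close> with \<open>\<sigma>\<close> permuting
  \<open>{1..n}\<close>. The choice \<open>b = Suc n\<close> leaves \<open>Suc n\<close> fixed and
  gives the linear factor; the others insert it into an arc.\<close>

lemma cycle_poly_Suc:
  assumes "p + q = 1"
  shows "cycle_poly (Suc n) r s p q x y =
    r * s * (p * x (Suc n) + q * y (Suc n)) * cycle_poly n r s p q x y +
    r * (\<Sum>i=1..n. x i * cycle_poly n r s p q (x(i := 0)) y + y i * cycle_poly n r s p q x (y(i := 0)))"
proof -
  let ?w = "cycle_weight n r s p q" and ?w' = "cycle_weight (Suc n) r s p q x y"
  let ?P = "{\<sigma>. \<sigma> permutes {1..n}}"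
  have "cycle_poly (Suc n) r s p q x y =
      (\<Sum>b\<in>{1..Suc n}. \<Sum>\<sigma>\<in>?P. ?w' (transpose (Suc n) b \<circ> \<sigma>))"
    using sum_over_permutations_insert[of "{1..n}" "Suc n" ?w']
    by (simp add: cycle_poly_def atLeastAtMostSuc_conv del: o_apply)
  also have "\<dots> = (\<Sum>\<sigma>\<in>?P. ?w' \<sigma>) + (\<Sum>b=1..n. \<Sum>\<sigma>\<in>?P. ?w' (transpose (Suc n) b \<circ> \<sigma>))"
    by (simp add: add.commute)
  also have "(\<Sum>\<sigma>\<in>?P. ?w' \<sigma>) =
      r * s * (p * x (Suc n) + q * y (Suc n)) * cycle_poly n r s p q x y"
    by (simp add: cycle_weight_Suc cycle_poly_def sum_distrib_left)
  also have "(\<Sum>b=1..n. \<Sum>\<sigma>\<in>?P. ?w' (transpose (Suc n) b \<circ> \<sigma>)) =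
      (\<Sum>\<sigma>\<in>?P. \<Sum>b=1..n. ?w' (transpose (Suc n) b \<circ> \<sigma>))"
    by (rule sum.swap)
  also have "\<dots> = (\<Sum>\<sigma>\<in>?P. \<Sum>i=1..n. r * (x i * ?w (x(i := 0)) y \<sigma> + y i * ?w x (y(i := 0)) \<sigma>))"
  proof (rule sum.cong[OF refl])
    fix \<sigma> assume "\<sigma> \<in> ?P"
    then have \<sigma>: "\<sigma> permutes {1..n}" by simp
    \<comment> \<open>Substituting \<open>b = \<sigma> j\<close> names the broken arc by its tail,
      as the \<open>x\<close> terms require.\<close>
    have "(\<Sum>b=1..n. ?w' (transpose (Suc n) b \<circ> \<sigma>)) =
        (\<Sum>j=1..n. ?w' (transpose (Suc n) (\<sigma> j) \<circ> \<sigma>))"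
      using sum.permute[OF \<sigma>, of "\<lambda>b. ?w' (transpose (Suc n) b \<circ> \<sigma>)"] by (simp add: o_def)
    also have "\<dots> = (\<Sum>j=1..n. r * (x j * ?w (x(j := 0)) y \<sigma>)) +
        (\<Sum>j=1..n. r * (y (\<sigma> j) * ?w x (y(\<sigma> j := 0)) \<sigma>))"
      by (simp add: cycle_weight_transpose[OF \<sigma> _ assms] distrib_left sum.distrib del: o_apply)
    \<comment> \<open>For the \<open>y\<close> terms the sum returns to the head
      \<open>i = \<sigma> j\<close>.\<close>
    also have "(\<Sum>j=1..n. r * (y (\<sigma> j) * ?w x (y(\<sigma> j := 0)) \<sigma>)) =
        (\<Sum>i=1..n. r * (y i * ?w x (y(i := 0)) \<sigma>))"
      using sum.permute[OF \<sigma>, of "\<lambda>i. r * (y i * ?w x (y(i := 0)) \<sigma>)"] by (simp add: o_def)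
    finally show "(\<Sum>b=1..n. ?w' (transpose (Suc n) b \<circ> \<sigma>)) =
        (\<Sum>i=1..n. r * (x i * ?w (x(i := 0)) y \<sigma> + y i * ?w x (y(i := 0)) \<sigma>))"
      by (simp only: distrib_left sum.distrib)
  qed
  also have "\<dots> = (\<Sum>i=1..n. \<Sum>\<sigma>\<in>?P. r * (x i * ?w (x(i := 0)) y \<sigma> + y i * ?w x (y(i := 0)) \<sigma>))"
    by (rule sum.swap)
  also have "\<dots> = r * (\<Sum>i=1..n. x i * cycle_poly n r s p q (x(i := 0)) y +
      y i * cycle_poly n r s p q x (y(i := 0)))"
    by (simp add: cycle_poly_def sum_distrib_left sum.distrib distrib_left)
  finally show ?thesis .
qed

section \<open>Stability\<close>

definition affine_fun :: "(complex \<Rightarrow> complex) \<Rightarrow> bool" where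
  "affine_fun f \<longleftrightarrow> (\<exists>u v. \<forall>t. f t = u + v * t)"

lemma affine_fun_mult_const: "affine_fun f \<Longrightarrow> affine_fun (\<lambda>t. f t * c)"
  unfolding affine_fun_def
proof (elim exE)
  fix u v assume "\<forall>t. f t = u + v * t"
  then show "\<exists>u v. \<forall>t. f t * c = u + v * t"
    by (intro exI[of _ "u * c"] exI[of _ "v * c"]) (simp add: algebra_simps)
qed

lemma affine_fun_const_mult: "affine_fun f \<Longrightarrow> affine_fun (\<lambda>t. c * f t)"
  using affine_fun_mult_const[of f c] by (simp add: mult.commute)

lemma affine_fun_sum:
  assumes "\<And>i. i \<in> A \<Longrightarrow> affine_fun (f i)"
  shows "affine_fun (\<lambda>t. \<Sum>i\<in>A. f i t)"
proof -
  obtain u v where "\<And>i t. i \<in> A \<Longrightarrow> f i t = u i + v i * t"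
    using assms unfolding affine_fun_def by metis
  then have "(\<Sum>i\<in>A. f i t) = sum u A + sum v A * t" for t
    by (simp add: sum.distrib sum_distrib_right)
  then show ?thesis
    unfolding affine_fun_def by blast
qed

lemma affine_fun_prod:
  assumes "finite A" "j \<in> A" "affine_fun (f j)" "\<And>i t. i \<in> A \<Longrightarrow> i \<noteq> j \<Longrightarrow> f i t = g i"
  shows "affine_fun (\<lambda>t. \<Prod>i\<in>A. f i t)"
proof -
  have "(\<Prod>i\<in>A. f i t) = f j t * prod g (A - {j})" for t
    using assms by (simp add: prod.remove[of A j])
  then show ?thesis
    using affine_fun_mult_const[OF assms(3)] by simp
qed

lemma affine_fun_arc:
  "affine_fun (\<lambda>t. arc p q (x(i := t)) y i j)" "affine_fun (\<lambda>t. arc p q x (y(j := t)) i j)"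
proof -
  show "affine_fun (\<lambda>t. arc p q (x(i := t)) y i j)"
    unfolding affine_fun_def
    by (rule exI[of _ "arc p q (x(i := 0)) y i j"],
        rule exI[of _ "if i < j then 1 else if j < i then 0 else p"]) (auto simp: arc_def)
  show "affine_fun (\<lambda>t. arc p q x (y(j := t)) i j)"
    unfolding affine_fun_def
    by (rule exI[of _ "arc p q x (y(j := 0)) i j"],
        rule exI[of _ "if i < j then 0 else if j < i then 1 else q"]) (auto simp: arc_def)
qed

text \<open>For each permutation, \<open>x i\<close> can occur only in the arc leaving
  \<open>i\<close> and \<open>y i\<close> only in the arc entering \<open>i\<close>, so a single
  factor of the product depends on the variable.\<close>

lemma affine_fun_cycle_poly:
  assumes "i \<in> {1..n}"
  shows "affine_fun (\<lambda>t. cycle_poly n r s p q (x(i := t)) y)"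
    and "affine_fun (\<lambda>t. cycle_poly n r s p q x (y(i := t)))"
proof -
  show "affine_fun (\<lambda>t. cycle_poly n r s p q (x(i := t)) y)"
    unfolding cycle_poly_def cycle_weight_def
  proof (intro affine_fun_sum affine_fun_const_mult)
    fix \<sigma>
    show "affine_fun (\<lambda>t. \<Prod>k=1..n. arc p q (x(i := t)) y k (\<sigma> k))"
      by (rule affine_fun_prod[OF _ assms affine_fun_arc(1), where g = "\<lambda>k. arc p q x y k (\<sigma> k)"])
        (auto intro: arc_cong)
  qed
  show "affine_fun (\<lambda>t. cycle_poly n r s p q x (y(i := t)))"
    unfolding cycle_poly_def cycle_weight_def
  proof (intro affine_fun_sum affine_fun_const_mult)
    fix \<sigma> assume "\<sigma> \<in> {\<sigma>. \<sigma> permutes {1..n}}"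
    then have \<sigma>: "\<sigma> permutes {1..n}" by simp
    obtain j where j: "j \<in> {1..n}" "\<sigma> j = i"
      using permutes_image[OF \<sigma>] assms by (metis imageE)
    have "\<sigma> k \<noteq> i" if "k \<noteq> j" for k
      using that j(2) permutes_inj[OF \<sigma>] by (auto dest: injD)
    then have "arc p q x (y(i := t)) k (\<sigma> k) = arc p q x y k (\<sigma> k)" if "k \<noteq> j" for k t
      using that by (intro arc_cong) simp_all
    then show "affine_fun (\<lambda>t. \<Prod>k=1..n. arc p q x (y(i := t)) k (\<sigma> k))"
      using affine_fun_arc(2)[of p q x y i j]
      by (intro affine_fun_prod[OF _ j(1), where g = "\<lambda>k. arc p q x y k (\<sigma> k)"])
        (simp_all add: j(2))
  qed
qed

text \<open>For \<open>f t = u + v t\<close> with \<open>w = u / v\<close>, the quotient is \<open>1 / (1/z + 1/w)\<close>, and the root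
  \<open>-w\<close> of \<open>f\<close> is not in the upper half plane.\<close>

lemma Im_affine_quotient_nonneg:
  assumes "affine_fun f" and nz: "\<And>t. Im t > 0 \<Longrightarrow> f t \<noteq> 0" and z: "Im z > 0"
  shows "Im (z * f 0 / f z) \<ge> 0"
proof -
  obtain u v where f: "\<And>t. f t = u + v * t"
    using assms(1) by (auto simp: affine_fun_def)
  show ?thesis
  proof (cases "v = 0")
    case True
    then show ?thesis using z nz[OF z] by (simp add: f)
  next
    case False
    define w where "w = u / v"
    have f': "f t = v * (t + w)" for t
      using False by (simp add: f w_def field_simps)
    have w: "Im w \<ge> 0"
      using nz[of "- w"] by (force simp: f' not_le)
    have "z * f 0 / f z = z * w / (z + w)"
      using False by (simp add: f')
    also have "\<dots> = z * w * cnj (z + w) / of_real ((cmod (z + w))\<^sup>2)"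
      by (subst complex_div_cnj) simp
    also have "Im \<dots> = Im (z * w * cnj (z + w)) / (cmod (z + w))\<^sup>2"
      by (rule Im_divide_of_real)
    \<comment> \<open>Here \<open>z * w * cnj (z + w)\<close> expands to
      \<open>|z|^2 w + |w|^2 z\<close>.\<close>
    also have "Im (z * w * cnj (z + w)) = (cmod z)\<^sup>2 * Im w + (cmod w)\<^sup>2 * Im z"
      unfolding cmod_power2 by (simp add: algebra_simps power2_eq_square)
    finally show ?thesis
      using w z by simp
  qed
qed

text \<open>The induction keeps \<open>x\<close> and \<open>y\<close> arbitrary because the quotient
  bound needs nonvanishing of the smaller polynomial for every value of one variable in the upper
  half plane. Strict positivity comes from the two new variables.\<close>

lemma cycle_poly_nonzero:
  fixes r s p q :: real
  assumes "r > 0" "s > 0" "p \<ge> 0" "q \<ge> 0" "p + q = 1"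
    and "\<And>i. i \<in> {1..n} \<Longrightarrow> Im (x i) > 0" "\<And>i. i \<in> {1..n} \<Longrightarrow> Im (y i) > 0"
  shows "cycle_poly n r s p q x y \<noteq> 0"
  using assms(6,7)
proof (induction n arbitrary: x y)
  case 0
  show ?case by (simp add: cycle_poly_def cycle_weight_def cycles_of_def)
next
  case (Suc n)
  let ?G = "cycle_poly n r s p q"
  define l where "l = p * x (Suc n) + q * y (Suc n)"
  define S where "S = (\<Sum>i=1..n. x i * ?G (x(i := 0)) y / ?G x y + y i * ?G x (y(i := 0)) / ?G x y)"
  have G: "?G x y \<noteq> 0"
    using Suc.prems by (intro Suc.IH) auto
  have pq: "complex_of_real p + complex_of_real q = 1"
    using assms(5) by (metis of_real_1 of_real_add)
  have "cycle_poly (Suc n) r s p q x y = r * (s * l + S) * ?G x y"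
    unfolding cycle_poly_Suc[OF pq] l_def S_def
    using G by (simp add: algebra_simps sum_distrib_left sum_distrib_right)
  moreover have "Im (s * l + S) > 0"
  proof -
    have "Im l > 0"
    proof -
      \<comment> \<open>As \<open>p + q = 1\<close>, at least one of the nonnegative weights is
        positive.\<close>
      have "p * Im (x (Suc n)) + q * Im (y (Suc n)) > 0"
        using assms(3-5) Suc.prems[of "Suc n"]
        by (cases "p = 0") (auto intro!: add_pos_nonneg mult_nonneg_nonneg simp: less_imp_le)
      then show ?thesis by (simp add: l_def)
    qed
    then have "Im (s * l) > 0"
      using assms(2) by simp
    moreover have "Im S \<ge> 0"
      unfolding S_def Im_sum
    proof (rule sum_nonneg)
      fix i assume i: "i \<in> {1..n}"
      \<comment> \<open>Writing \<open>x\<close> as \<open>x(i := x i)\<close> exhibits the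
        denominator as the affine function at \<open>z = x i\<close>.\<close>
      have "Im (x i * ?G (x(i := 0)) y / ?G (x(i := x i)) y) \<ge> 0"
        using i Suc.prems
        by (intro Im_affine_quotient_nonneg[OF affine_fun_cycle_poly(1)] Suc.IH) auto
      moreover have "Im (y i * ?G x (y(i := 0)) / ?G x (y(i := y i))) \<ge> 0"
        using i Suc.prems
        by (intro Im_affine_quotient_nonneg[OF affine_fun_cycle_poly(2)] Suc.IH) auto
      ultimately show "Im (x i * ?G (x(i := 0)) y / ?G x y + y i * ?G x (y(i := 0)) / ?G x y) \<ge> 0"
        by simp
    qed
    ultimately show ?thesis by simp
  qed
  then have "s * l + S \<noteq> 0"
    by (metis less_irrefl zero_complex.simps(2))
  ultimately show ?case
    using G assms(1) by simp
qed

text \<open>The cycle of 1 is counted by \<open>zc\<close> or \<open>nc\<close>, so some exponent of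
  0 is positive; this matters since \<open>0 ^ 0 = 1\<close>.\<close>

lemma F_poly_0_0:
  assumes "n > 0"
  shows "F_poly n r x y 0 0 = 0"
  unfolding F_poly_def
proof (rule sum.neutral, clarify)
  fix \<kappa> \<sigma>
  have "orbit \<sigma> 1 \<in> cycles_of n \<sigma>"
    using assms by (auto simp: cycles_of_def)
  then have "zc n (\<kappa>, \<sigma>) \<noteq> 0 \<or> nc n (\<kappa>, \<sigma>) \<noteq> 0"
    by (auto simp: zc_def nc_def)
  then show "of_real (0 ^ nc n (\<kappa>, \<sigma>) * 0 ^ zc n (\<kappa>, \<sigma>)) * prod x (X_set n (\<kappa>, \<sigma>)) *
      prod y (Y_set n (\<kappa>, \<sigma>)) = 0"
    by auto
qed

theorem theorem5p5:
  fixes n r :: nat and a b :: real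
  assumes "r > 1" and "n > 0" and "a \<ge> 0" and "b \<ge> 0"
  shows "stable_poly ({1..n} <+> {1..n})
           (\<lambda>z. F_poly n r (\<lambda>i. z (Inl i)) (\<lambda>j. z (Inr j)) a b)"
\<comment> \<open>In the first case \<open>c = 0\<close>, and stability holds by the convention on
  the zero polynomial. Otherwise \<open>c > 0\<close>, and division by \<open>c\<close> is
  legitimate.\<close>
proof (cases "a = 0 \<and> b = 0")
  case True
  then show ?thesis
    using F_poly_0_0[OF assms(2)] by (simp add: stable_poly_def)
next
  case False
  define c where "c = real (r - 1) * a + b"
  have c: "c > 0"
  proof (cases "a = 0")
    case True
    then show ?thesis using False assms(4) by (simp add: c_def)
  next
    case False
    then have "real (r - 1) * a > 0"
      using assms by simp
    then show ?thesis using assms(4) unfolding c_def by linarith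
  qed
  have 1: "real (r - 1) * a / c + b / c = 1"
    using c by (simp add: c_def flip: add_divide_distrib)
  have "F_poly n r (\<lambda>i. z (Inl i)) (\<lambda>j. z (Inr j)) a b \<noteq> 0"
    if "\<forall>v\<in>{1..n} <+> {1..n}. Im (z v) > 0" for z
  proof -
    have "cycle_poly n (of_real (real r)) (of_real (c / real r)) (of_real (real (r - 1) * a / c))
        (of_real (b / c)) (\<lambda>i. z (Inl i)) (\<lambda>j. z (Inr j)) \<noteq> 0"
      using assms c that by (intro cycle_poly_nonzero 1) auto
    then show ?thesis
      using F_poly_eq_cycle_poly[OF _ c_def] assms c by simp
  qed
  then show ?thesis
    by (simp add: stable_poly_def)
qed

end
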